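(* Let $A_1,\ldots,A_n$ be $n$ events in a probability space. Then, for each integer $k$ with $2\le k\le n$, $$\mathbb{P}(\text{at least }k\text{ out of the }n\text{ events }A_i\text{ occur})\le\min\{A,B\},$$ where $$A:=\min_{2\le m\le k}\left[\frac{S_1-S'_m}{k}+\frac{k-m+1}{k}\cdot\max_{i_1<\cdots<i_{m-1}}\mathbb{P}(A_{i_1}\cap\cdots\cap A_{i_{m-1}})\right],\qquad B:=\min_{1\le m\le k}\frac{S_m}{\binom{k}{m}}.$$
   Context: For $1\le m\le n$, $$S_m=\sum_{1\le i_1<\cdots<i_m\le n}\mathbb{P}(A_{i_1}\cap\cdots\cap A_{i_m}),$$ and for $2\le m\le n$, $$S'_m=\max_{i_1<\cdots<i_{m-1}}\ \sum_{j=1,\ j\notin\{i_1,\ldots,i_{m-1}\}}^{n}\mathbb{P}(A_j\cap A_{i_1}\cap\cdots\cap A_{i_{m-1}}),$$ where maxima are over indices $1\le i_1<\cdots<i_{m-1}\le n$. *)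

theory Defs
  imports "HOL-Probability.Probability"
begin

text \<open>A choice of indices \<open>1 \<le> i\<^sub>1 < \<dots> < i\<^sub>m \<le> n\<close> is represented by the
  \<open>m\<close>-element set \<open>{i\<^sub>1, \<dots>, i\<^sub>m}\<close>.\<close>

definition index_sets :: "nat \<Rightarrow> nat \<Rightarrow> nat set set" where
  "index_sets n m = {I. I \<subseteq> {1..n} \<and> card I = m}"

text \<open>The quantities below are meant for \<open>1 \<le> m \<le> n\<close> (\<open>2 \<le> m \<le> n\<close> for \<open>S'_sum\<close>): then every
  intersection is over a nonempty index set, and every maximum is over a nonempty finite set.\<close>

definition S_sum :: "'a measure \<Rightarrow> (nat \<Rightarrow> 'a set) \<Rightarrow> nat \<Rightarrow> nat \<Rightarrow> real" where
  "S_sum M A n m = (\<Sum>I\<in>index_sets n m. measure M (\<Inter>i\<in>I. A i))"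

definition S'_sum :: "'a measure \<Rightarrow> (nat \<Rightarrow> 'a set) \<Rightarrow> nat \<Rightarrow> nat \<Rightarrow> real" where
  "S'_sum M A n m =
     (MAX I\<in>index_sets n (m - 1). \<Sum>j\<in>{1..n} - I. measure M (A j \<inter> (\<Inter>i\<in>I. A i)))"

definition max_inter_prob :: "'a measure \<Rightarrow> (nat \<Rightarrow> 'a set) \<Rightarrow> nat \<Rightarrow> nat \<Rightarrow> real" where
  "max_inter_prob M A n m = (MAX I\<in>index_sets n m. measure M (\<Inter>i\<in>I. A i))"

end

theory Submission
  imports Defs
begin

text \<open>Write \<open>N x\<close> for the number of events containing \<open>x\<close>. Both bounds are expectations of
  pointwise inequalities. For \<open>B\<close>, \<open>(k choose m) 1\<^bsub>{N \<ge> k}\<^esub> \<le> N choose m\<close>, and \<open>N choose m\<close> has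
  expectation \<open>S\<^sub>m\<close>. For \<open>A\<close>, let \<open>I\<close> be a set of \<open>m - 1\<close> indices attaining the maximum \<open>S'\<^sub>m\<close> and
  \<open>C\<close> the intersection of the corresponding events; then
  \<open>k 1\<^bsub>{N \<ge> k}\<^esub> \<le> N - (N - (m - 1)) 1\<^bsub>C\<^esub> + (k - m + 1) 1\<^bsub>C\<^esub>\<close>, since off \<open>C\<close> the right-hand side
  is \<open>N\<close> and on \<open>C\<close> it is \<open>k\<close>.\<close>

text \<open>This is the \<open>N x\<close> of the overview; unfolding it gives the cardinality in
  the theorem.\<close>

definition occ :: "(nat \<Rightarrow> 'a set) \<Rightarrow> nat \<Rightarrow> 'a \<Rightarrow> nat" where
  "occ A n x = card {i \<in> {1..n}. x \<in> A i}"

lemma finite_index_sets: "finite (index_sets n m)"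
  by (rule finite_subset[of _ "Pow {1..n}"]) (auto simp: index_sets_def)

lemma index_sets_nonempty: "m \<le> n \<Longrightarrow> index_sets n m \<noteq> {}"
  using obtain_subset_with_card_n[of m "{1..n}"] by (auto simp: index_sets_def)

text \<open>\<open>0 < m\<close> excludes the empty index set, whose intersection is
  \<open>UNIV\<close> rather than \<open>space M\<close>.\<close>

lemma INT_in_sets:
  assumes "\<And>i. i \<in> {1..n} \<Longrightarrow> A i \<in> sets M" "I \<in> index_sets n m" "0 < m"
  shows "(\<Inter>i\<in>I. A i) \<in> sets M"
proof (rule sets.finite_INT)
  show "finite I" "I \<noteq> {}"
    using assms(2,3) by (auto simp: index_sets_def intro: finite_subset)
  show "A i \<in> sets M" if "i \<in> I" for i
    using assms(1,2) that by (auto simp: index_sets_def)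
qed

lemma sum_indicator_occ:
  "(\<Sum>i\<in>{1..n}. indicator (A i) x) = real (occ A n x)"
  by (simp add: occ_def indicator_def sum.If_cases Int_def)

text \<open>The summands equal to 1 belong to the \<open>m\<close>-element subsets of the set of
  indices whose events contain \<open>x\<close>.\<close>

lemma sum_indicator_INT_occ:
  "(\<Sum>I\<in>index_sets n m. indicator (\<Inter>i\<in>I. A i) x) = real (occ A n x choose m)"
proof -
  have "index_sets n m \<inter> {I. x \<in> (\<Inter>i\<in>I. A i)} = {J. J \<subseteq> {i \<in> {1..n}. x \<in> A i} \<and> card J = m}"
    by (auto simp: index_sets_def)
  then show ?thesis
    by (simp add: indicator_def sum.If_cases finite_index_sets n_subsets occ_def)
qed

text \<open>If \<open>x\<close> lies in the intersection, the \<open>m\<close> events indexed by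
  \<open>I\<close> all contain \<open>x\<close>, so the other indices account for the remaining
  \<open>occ A n x - m\<close>. Otherwise both sides vanish.\<close>

lemma sum_indicator_Int_occ:
  assumes "I \<in> index_sets n m"
  shows "(\<Sum>j\<in>{1..n} - I. indicator (A j \<inter> (\<Inter>i\<in>I. A i)) x)
    = (real (occ A n x) - real m) * indicator (\<Inter>i\<in>I. A i) x"
proof -
  have I: "I \<subseteq> {1..n}" "card I = m" "finite I"
    using assms by (auto simp: index_sets_def intro: finite_subset)
  show ?thesis
  proof (cases "x \<in> (\<Inter>i\<in>I. A i)")
    case True
    then have "(\<Sum>j\<in>I. indicator (A j) x) = real m"
      using I by simp
    moreover have "(\<Sum>j\<in>{1..n}. indicator (A j) x) =
        (\<Sum>j\<in>{1..n} - I. indicator (A j) x) + (\<Sum>j\<in>I. indicator (A j) x :: real)"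
      using I by (intro sum.subset_diff) auto
    ultimately show ?thesis
      using True sum_indicator_occ[of A x n]
      by (simp add: indicator_inter_arith)
  qed (simp add: indicator_inter_arith)
qed

lemma has_bochner_integral_mono:
  fixes f g :: "'a \<Rightarrow> real"
  assumes "has_bochner_integral M f a" "has_bochner_integral M g b"
    and "\<And>x. x \<in> space M \<Longrightarrow> f x \<le> g x"
  shows "a \<le> b"
  using assms integral_mono[of M f g] by (simp add: has_bochner_integral_iff)

context prob_space
begin

lemma has_integral_sum_indicator:
  assumes "\<And>i. i \<in> I \<Longrightarrow> C i \<in> events"
  shows "has_bochner_integral M (\<lambda>x. \<Sum>i\<in>I. indicator (C i) x :: real) (\<Sum>i\<in>I. prob (C i))"
  using assms
  by (intro has_bochner_integral_sum has_bochner_integral_real_indicator)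
    (auto simp: emeasure_eq_measure)

lemma occ_ge_in_events:
  assumes "\<And>i. i \<in> {1..n} \<Longrightarrow> A i \<in> events"
  shows "{x \<in> space M. k \<le> occ A n x} \<in> events"
proof -
  \<comment> \<open>As a sum of indicators, the count is visibly a measurable function.\<close>
  have "{x \<in> space M. real k \<le> (\<Sum>i\<in>{1..n}. indicator (A i) x)} \<in> events"
    using assms by measurable
  then show ?thesis
    by (simp only: sum_indicator_occ of_nat_le_iff)
qed

lemma has_integral_occ_choose:
  assumes "\<And>i. i \<in> {1..n} \<Longrightarrow> A i \<in> events" "0 < m"
  shows "has_bochner_integral M (\<lambda>x. real (occ A n x choose m)) (S_sum M A n m)"
  unfolding S_sum_def sum_indicator_INT_occ[symmetric]
  using INT_in_sets[OF assms(1)] assms(2) by (intro has_integral_sum_indicator)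

text \<open>Markov's inequality for \<open>occ A n x choose m\<close>, which is at least
  \<open>k choose m\<close> on the event because binomials grow in the upper argument.\<close>

lemma prob_occ_ge_le_S_sum:
  assumes A: "\<And>i. i \<in> {1..n} \<Longrightarrow> A i \<in> events" and m: "1 \<le> m" "m \<le> k"
  shows "prob {x \<in> space M. k \<le> occ A n x} \<le> S_sum M A n m / real (k choose m)"
proof -
  let ?E = "{x \<in> space M. k \<le> occ A n x}"
  have "has_bochner_integral M (\<lambda>x. real (k choose m) * indicator ?E x) (real (k choose m) * prob ?E)"
    using occ_ge_in_events[OF A]
    by (intro has_bochner_integral_mult_right has_bochner_integral_real_indicator)
      (auto simp: emeasure_eq_measure)
  moreover have "has_bochner_integral M (\<lambda>x. real (occ A n x choose m)) (S_sum M A n m)"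
    using has_integral_occ_choose[OF A] m by simp
  ultimately have "real (k choose m) * prob ?E \<le> S_sum M A n m"
    by (rule has_bochner_integral_mono) (auto simp: indicator_def intro: binomial_right_mono)
  then show ?thesis
    using m by (simp add: field_simps)
qed

lemma prob_occ_ge_le_S'_sum:
  assumes A: "\<And>i. i \<in> {1..n} \<Longrightarrow> A i \<in> events" and m: "2 \<le> m" "m \<le> k" "k \<le> n"
  shows "prob {x \<in> space M. k \<le> occ A n x} \<le> (S_sum M A n 1 - S'_sum M A n m) / real k
    + (real k - real m + 1) / real k * max_inter_prob M A n (m - 1)"
proof -
  let ?E = "{x \<in> space M. k \<le> occ A n x}"
  let ?f = "\<lambda>I. \<Sum>j\<in>{1..n} - I. prob (A j \<inter> (\<Inter>i\<in>I. A i))"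
  \<comment> \<open>The maximum is attained: there are finitely many index sets, and at least one
    since \<open>m - 1 \<le> n\<close>.\<close>
  have "S'_sum M A n m \<in> ?f ` index_sets n (m - 1)"
    unfolding S'_sum_def using m
    by (intro Max_in finite_imageI finite_index_sets) (simp add: index_sets_nonempty)
  then obtain I where I: "I \<in> index_sets n (m - 1)" and S': "S'_sum M A n m = ?f I"
    by blast
  define C where "C = (\<Inter>i\<in>I. A i)"
  have C: "C \<in> events"
    unfolding C_def using INT_in_sets[OF A I] m by simp
  have intS': "has_bochner_integral M
      (\<lambda>x. (real (occ A n x) - real (m - 1)) * indicator C x) (S'_sum M A n m)"
    using has_integral_sum_indicator[of "{1..n} - I" "\<lambda>j. A j \<inter> C"] A C
    unfolding S' C_def sum_indicator_Int_occ[OF I] by blast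
  have intS: "has_bochner_integral M (\<lambda>x. real (occ A n x)) (S_sum M A n 1)"
    using has_integral_occ_choose[OF A, where m = 1] by simp
  have intC: "has_bochner_integral M (\<lambda>x. (real k - real m + 1) * indicator C x)
      ((real k - real m + 1) * prob C)"
    using C by (intro has_bochner_integral_mult_right has_bochner_integral_real_indicator)
      (auto simp: emeasure_eq_measure)
  have intE: "has_bochner_integral M (\<lambda>x. real k * indicator ?E x) (real k * prob ?E)"
    using occ_ge_in_events[OF A]
    by (intro has_bochner_integral_mult_right has_bochner_integral_real_indicator)
      (auto simp: emeasure_eq_measure)
  \<comment> \<open>Integrate the pointwise inequality of the overview; \<open>2 \<le> m\<close>
    gives \<open>real (m - 1) = real m - 1\<close>, so the right-hand side is exactly
    \<open>k\<close> on \<open>C\<close>.\<close>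
  have "real k * prob ?E \<le> S_sum M A n 1 - S'_sum M A n m + (real k - real m + 1) * prob C"
    by (rule has_bochner_integral_mono[OF intE has_bochner_integral_add[OF
          has_bochner_integral_diff[OF intS intS'] intC]])
      (use m in \<open>auto simp: indicator_def of_nat_diff\<close>)
  \<comment> \<open>\<open>I\<close> was chosen to attain \<open>S'_sum\<close> and need not
    maximize the probability of the intersection. The bound may still be substituted, as its
    coefficient is nonnegative by \<open>m \<le> k\<close>.\<close>
  also have "prob C \<le> max_inter_prob M A n (m - 1)"
    unfolding max_inter_prob_def C_def using I by (intro Max_ge) (auto simp: finite_index_sets)
  finally have "real k * prob ?E \<le> S_sum M A n 1 - S'_sum M A n m
      + (real k - real m + 1) * max_inter_prob M A n (m - 1)"
    using m by (simp add: mult_left_mono)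
  then show ?thesis
    using m by (simp add: pos_le_divide_eq mult.commute[of _ "real k"] flip: add_divide_distrib)
qed

end

theorem theorem4p2:
  fixes M :: "'a measure" and A :: "nat \<Rightarrow> 'a set" and n k :: nat
  assumes "prob_space M"
    and "\<And>i. i \<in> {1..n} \<Longrightarrow> A i \<in> sets M"
    and "2 \<le> k" and "k \<le> n"
  shows "measure M {x \<in> space M. k \<le> card {i \<in> {1..n}. x \<in> A i}}
    \<le> min
        (MIN m\<in>{2..k}. (S_sum M A n 1 - S'_sum M A n m) / real k
            + (real k - real m + 1) / real k * max_inter_prob M A n (m - 1))
        (MIN m\<in>{1..k}. S_sum M A n m / real (k choose m))"
proof -
  interpret prob_space M by fact
  have "prob {x \<in> space M. k \<le> occ A n x} \<le> min
        (MIN m\<in>{2..k}. (S_sum M A n 1 - S'_sum M A n m) / real k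
            + (real k - real m + 1) / real k * max_inter_prob M A n (m - 1))
        (MIN m\<in>{1..k}. S_sum M A n m / real (k choose m))"
  proof (intro min.boundedI Min.boundedI; (elim imageE)?)
    fix b m
    assume "b = (S_sum M A n 1 - S'_sum M A n m) / real k
        + (real k - real m + 1) / real k * max_inter_prob M A n (m - 1)" "m \<in> {2..k}"
    then show "prob {x \<in> space M. k \<le> occ A n x} \<le> b"
      using prob_occ_ge_le_S'_sum[OF assms(2)] assms(4) by simp
  next
    fix b m
    assume "b = S_sum M A n m / real (k choose m)" "m \<in> {1..k}"
    then show "prob {x \<in> space M. k \<le> occ A n x} \<le> b"
      using prob_occ_ge_le_S_sum[OF assms(2)] by simp
  \<comment> \<open>What remains is that both minima range over finite nonempty sets;
    \<open>2 \<le> k\<close> makes the ranges of \<open>m\<close> nonempty.\<close>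
  qed (use assms(3) in auto)
  then show ?thesis
    by (simp only: occ_def)
qed

end
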